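(* Let $n\ge 2$ and let $b(x)=\frac{1}{2n}x^{2n}+\sum_{j=2}^{2n-1}a_jx^j$ with real coefficients $a_j$. Let $x,r,y,t\in\mathbb{R}$. If $[(x+iy,\,t+ib(x)),\,(r+iy,\,t+ib(r))]\in\Sigma$, then $S[(x,y,t),(r,y,t)]$ is infinite. Also, for $h,k$ with $\delta=h+k>0$, $$\lim_{\delta\to0^+}S\big[(x+iy,\;t+i(b(x)+h)),\,(r+iy,\;t+i(b(r)+k))\big]=\infty .$$
   Context: Let $\Omega=\{(z_1,z_2)\in\mathbb{C}^2:\operatorname{Im} z_2>b(\operatorname{Re} z_1)\}$. For $\eta\in\mathbb{R}$, $\tau>0$, $N(\eta,\tau)=\int_{-\infty}^\infty e^{2\tau[\eta\lambda-b(\lambda)]}\,d\lambda$. The Szegő kernel of $\Omega$ is $$S(z,w)=c\int_0^\infty\!\!\int_{-\infty}^\infty\tau\,e^{\eta\tau[z_1+\bar w_1]+i\tau[z_2-\bar w_2]}\,[N(\eta,\tau)]^{-1}\,d\eta\,d\tau,$$ where $c>0$ is an absolute constant. On the boundary, identified with $\mathbb{R}^3$ via $(x,y,t)\leftrightarrow(x+iy,t+ib(x))$, it reads $$S[(x,y,t),(r,s,u)]=c\int_0^\infty\!\!\int_{-\infty}^\infty\tau\,e^{\tau[i(t-u)+i\eta(y-s)-[b(x)+b(r)-\eta(x+r)]]}[N(\eta,\tau)]^{-1}\,d\eta\,d\tau .$$ When $s=y$ and $u=t$ the integrand is real and positive, and "infinite" means that this integral diverges to $+\infty$. For $\eta\in\mathbb{R}$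 set $B_\eta(x)=-\eta x+b(x)$ and $\Lambda_\eta=\{\lambda\in\mathbb{R}:\inf_xB_\eta(x)=B_\eta(\lambda)\}$. Set $\Lambda=\bigcup_\eta\Lambda_\eta$ and $\mathcal{C}=\{\eta:|\Lambda_\eta|>1\}$. Writing $z=(x+iy,\,t+ib(x)+ih)$ and $w=(r+is,\,u+ib(r)+ik)$, $$\Sigma=\{(z,w):x=r\text{ and }x\in\Lambda\}\cup\{(z,w):x,r\in\Lambda_c\text{ for some }c\in\mathcal{C}\}.$$ The limit is taken at fixed $x,r,y,t$ such that $[(x+iy,t+ib(x)),(r+iy,t+ib(r))]\in\Sigma$. *)

theory Defs
  imports "HOL-Analysis.Analysis"
begin

definition weightN :: "(real \<Rightarrow> real) \<Rightarrow> real \<Rightarrow> real \<Rightarrow> real" where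
  "weightN b \<eta> \<tau> = (LINT l|lborel. exp (2 * \<tau> * (\<eta> * l - b l)))"

text \<open>
  The Szego kernel of the domain Im z2 > b (Re z1), up to the absolute constant c, which is
  kept as a parameter.  The formula is a Bochner integral, so its value is 0 by convention
  wherever the integral does not converge.
\<close>

definition szego_integrand ::
  "(real \<Rightarrow> real) \<Rightarrow> complex \<times> complex \<Rightarrow> complex \<times> complex \<Rightarrow> real \<Rightarrow> real \<Rightarrow> complex" where
  "szego_integrand b z w \<eta> \<tau> =
     of_real \<tau> *
     exp (of_real (\<eta> * \<tau>) * (fst z + cnj (fst w)) + \<i> * of_real \<tau> * (snd z - cnj (snd w))) /
     of_real (weightN b \<eta> \<tau>)"

definition szego ::
  "real \<Rightarrow> (real \<Rightarrow> real) \<Rightarrow> complex \<times> complex \<Rightarrow> complex \<times> complex \<Rightarrow> complex" where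
  "szego c b z w =
     of_real c * (LINT \<tau>:{0<..}|lborel. (LINT \<eta>|lborel. szego_integrand b z w \<eta> \<tau>))"

fun szego_bdry_integrand ::
  "(real \<Rightarrow> real) \<Rightarrow> real \<times> real \<times> real \<Rightarrow> real \<times> real \<times> real \<Rightarrow> real \<Rightarrow> real \<Rightarrow> complex" where
  "szego_bdry_integrand b (x, y, t) (r, s, u) \<eta> \<tau> =
     of_real \<tau> *
     exp (of_real \<tau> * (\<i> * of_real (t - u) + \<i> * of_real \<eta> * of_real (y - s)
                       - of_real (b x + b r - \<eta> * (x + r)))) /
     of_real (weightN b \<eta> \<tau>)"

fun bdry_point :: "(real \<Rightarrow> real) \<Rightarrow> real \<times> real \<times> real \<Rightarrow> complex \<times> complex" where
  "bdry_point b (x, y, t) = (Complex x y, Complex t (b x))"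

lemma szego_integrand_bdry_point:
  "szego_integrand b (bdry_point b p) (bdry_point b q) \<eta> \<tau> = szego_bdry_integrand b p q \<eta> \<tau>"
proof (cases p; cases q)
  fix x y t r s u assume p: "p = (x, y, t)" and q: "q = (r, s, u)"
  have "of_real (\<eta> * \<tau>) * (Complex x y + cnj (Complex r s))
          + \<i> * of_real \<tau> * (Complex t (b x) - cnj (Complex u (b r)))
      = of_real \<tau> * (\<i> * of_real (t - u) + \<i> * of_real \<eta> * of_real (y - s)
                       - of_real (b x + b r - \<eta> * (x + r)))"
    by (simp add: complex_eq_iff algebra_simps)
  then show ?thesis
    by (simp only: p q szego_integrand_def bdry_point.simps fst_conv snd_conv
        szego_bdry_integrand.simps)
qed

text \<open>
  The boundary kernel is infinite when its integrand is real and positive (as it is for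
  s = y and u = t) and the integral diverges to infinity.
\<close>

definition szego_bdry_infinite ::
  "real \<Rightarrow> (real \<Rightarrow> real) \<Rightarrow> real \<times> real \<times> real \<Rightarrow> real \<times> real \<times> real \<Rightarrow> bool" where
  "szego_bdry_infinite c b p q \<longleftrightarrow>
     (\<forall>\<tau>>0. \<forall>\<eta>. szego_bdry_integrand b p q \<eta> \<tau> \<in> \<real> \<and> Re (szego_bdry_integrand b p q \<eta> \<tau>) > 0) \<and>
     ennreal c * (\<integral>\<^sup>+\<tau>\<in>{0<..}. (\<integral>\<^sup>+\<eta>. ennreal (Re (szego_bdry_integrand b p q \<eta> \<tau>)) \<partial>lborel) \<partial>lborel)
       = \<infinity>"

definition Bfun :: "(real \<Rightarrow> real) \<Rightarrow> real \<Rightarrow> real \<Rightarrow> real" where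
  "Bfun b \<eta> x = - \<eta> * x + b x"

text \<open>
  The infimum is taken in the reals, so the following is meaningful when every
  Bfun b eta is bounded below, as for polynomials b of even degree at least 2 with
  positive leading coefficient.
\<close>

definition Lambda_at :: "(real \<Rightarrow> real) \<Rightarrow> real \<Rightarrow> real set" where
  "Lambda_at b \<eta> = {l. (INF x. Bfun b \<eta> x) = Bfun b \<eta> l}"

definition Lambda :: "(real \<Rightarrow> real) \<Rightarrow> real set" where
  "Lambda b = (\<Union>\<eta>. Lambda_at b \<eta>)"

text \<open>The disjunct for infinite sets is needed because card is 0 on those.\<close>

definition Cset :: "(real \<Rightarrow> real) \<Rightarrow> real set" where
  "Cset b = {\<eta>. infinite (Lambda_at b \<eta>) \<or> card (Lambda_at b \<eta>) > 1}"

definition Sigma_set :: "(real \<Rightarrow> real) \<Rightarrow> ((complex \<times> complex) \<times> (complex \<times> complex)) set" where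
  "Sigma_set b =
     {((Complex x y, Complex t (b x + h)), (Complex r s, Complex u (b r + k))) | x y t h r s u k.
        x = r \<and> x \<in> Lambda b} \<union>
     {((Complex x y, Complex t (b x + h)), (Complex r s, Complex u (b r + k))) | x y t h r s u k.
        \<exists>c\<in>Cset b. x \<in> Lambda_at b c \<and> r \<in> Lambda_at b c}"

text \<open>The meaning of a limit equal to infinity for the complex-typed kernel: the values are eventually
  real and exceed every bound, which is stronger than convergence of the moduli to infinity.\<close>

definition tends_to_pinfty :: "('a \<Rightarrow> complex) \<Rightarrow> 'a filter \<Rightarrow> bool" where
  "tends_to_pinfty f F \<longleftrightarrow> (\<forall>\<^sub>F p in F. f p \<in> \<real>) \<and> filterlim (\<lambda>p. Re (f p)) at_top F"

end

theory Submission
  imports Defs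
begin

text \<open>
  Both assertions concern one positive function.  Put
  \<open>D \<eta> \<tau> = \<tau> exp (\<tau> (\<eta> (x + r) - b x - b r)) / N(\<eta>, \<tau>)\<close>.  Two points with the same
  coordinates \<open>y\<close> and \<open>t\<close> at total height \<open>\<delta> = h + k\<close> above the boundary have kernel
  \<open>c \<integral> e\<^sup>-\<^sup>\<tau>\<^sup>\<delta> J(\<tau>) d\<tau>\<close> over \<open>\<tau> > 0\<close>, where \<open>J(\<tau>) = \<integral> D \<eta> \<tau> d\<eta>\<close>, and \<open>\<delta> = 0\<close> is the boundary
  kernel.  So the divergence follows once \<open>J\<close> is known not to decay.

  Membership in \<open>\<Sigma>\<close> says that \<open>x\<close> and \<open>r\<close> maximize \<open>l \<mapsto> \<eta>\<^sub>0 l - b l\<close> for a common \<open>\<eta>\<^sub>0\<close>;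
  let \<open>M\<close> be the maximum.  On the window \<open>\<bar>\<eta> - \<eta>\<^sub>0\<bar> \<le> 1/\<tau>\<close> the numerator of \<open>D\<close> is comparable
  to \<open>\<tau> exp (2 \<tau> M)\<close>, and for \<open>\<tau> \<ge> 1\<close> the weight \<open>N(\<eta>, \<tau>)\<close> is at most a constant times
  \<open>exp (2 \<tau> M)\<close>.  The exponentials cancel, the window has length \<open>2/\<tau>\<close>, and hence \<open>J\<close> is
  bounded below by a positive constant (\<open>fibre_integral_lower\<close>).
  The boundary integral therefore diverges, and for small \<open>\<delta>\<close> the interior one is at least a
  constant times \<open>1/\<delta>\<close>.

  The second claim also needs the interior integral to converge for each \<open>\<delta> > 0\<close>, since a
  divergent Bochner integral has the value \<open>0\<close>.
  This comes from continuity of \<open>b\<close>: near \<open>x\<close> and \<open>r\<close> the function \<open>b\<close> varies by at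
  most \<open>\<epsilon>\<close>, so integrating over a piece of such a neighbourhood on the side selected by the sign of
  \<open>\<eta>\<close> bounds \<open>N\<close> from below and gives
  \<open>D \<eta> \<tau> \<le> (2/\<rho>) \<tau> exp (2 \<tau> \<epsilon> - \<tau> \<rho> \<bar>\<eta>\<bar>)\<close> (\<open>szego_density_upper\<close>).  Taking \<open>\<epsilon> < \<delta>/2\<close>
  suffices.
\<close>

section \<open>Superlinear growth and the weight\<close>

definition superlinear :: "(real \<Rightarrow> real) \<Rightarrow> bool" where
  "superlinear b \<longleftrightarrow> (\<forall>K. \<exists>C. \<forall>l. K * \<bar>l\<bar> - C \<le> b l)"

lemma integrable_exp_neg_abs:
  assumes "k > 0"
  shows "integrable lborel (\<lambda>x::real. exp (- (k * \<bar>x\<bar>)))"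
proof -
  have "((\<lambda>x. exp (- k * x)) has_integral exp (- k * 0) / k) {0..}"
    using assms by (rule has_integral_exp_minus_to_infinity)
  then have "(\<lambda>x. exp (- k * x)) absolutely_integrable_on {0..}"
    by (intro nonnegative_absolutely_integrable_1) auto
  then have "set_integrable lborel {0..} (\<lambda>x. exp (- k * x))"
    unfolding set_integrable_def
    by (subst (asm) integrable_completion) auto
  then have i: "integrable lborel (\<lambda>x::real. indicator {0..} x * exp (- k * x))"
    by (simp add: set_integrable_def)
  have "integrable lborel (\<lambda>x::real. indicator {0..} (0 + (-1) * x) * exp (- k * (0 + (-1) * x)))"
    by (rule lborel_integrable_real_affine[OF i]) simp
  from Bochner_Integration.integrable_add[OF i this]
  show ?thesis
    by (rule Bochner_Integration.integrable_bound)
       (auto simp: indicator_def abs_if)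
qed

text \<open>
  The factor \<open>exp (k \<bar>l\<bar>)\<close> leaves room for perturbing the slope \<open>\<eta>\<close>; growth of \<open>b\<close> at a rate
  exceeding every linear one absorbs it.
\<close>

lemma integrable_weight:
  assumes b: "superlinear b" and c: "continuous_on UNIV b" and s: "s > 0"
  shows "integrable lborel (\<lambda>l. exp (s * (\<eta> * l - b l) + k * \<bar>l\<bar>))"
proof -
  obtain C where C: "\<And>l. ((\<bar>k\<bar> + 1) / s + \<bar>\<eta>\<bar>) * \<bar>l\<bar> - C \<le> b l"
    using b unfolding superlinear_def by blast
  have [measurable]: "b \<in> borel_measurable borel"
    using c by (rule borel_measurable_continuous_onI)
  have le: "s * (\<eta> * l - b l) + k * \<bar>l\<bar> \<le> s * C - 1 * \<bar>l\<bar>" for l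
  proof -
    have "\<eta> * l \<le> \<bar>\<eta>\<bar> * \<bar>l\<bar>"
      by (metis abs_ge_self abs_mult)
    with C[of l] have "\<eta> * l - b l \<le> C - (\<bar>k\<bar> + 1) / s * \<bar>l\<bar>"
      by (simp add: algebra_simps)
    with s have "s * (\<eta> * l - b l) \<le> s * (C - (\<bar>k\<bar> + 1) / s * \<bar>l\<bar>)"
      by (intro mult_left_mono) auto
    also have "\<dots> = s * C - (\<bar>k\<bar> + 1) * \<bar>l\<bar>"
      using s by (simp add: field_simps)
    finally show ?thesis
      using mult_right_mono[OF abs_ge_self[of k] abs_ge_zero[of l]] by (simp add: algebra_simps)
  qed
  have "integrable lborel (\<lambda>l. exp (s * C) * exp (- (1 * \<bar>l\<bar>)))"
    by (intro integrable_mult_right integrable_exp_neg_abs) simp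
  then show ?thesis
    by (rule Bochner_Integration.integrable_bound)
       (use le in \<open>auto simp: exp_add[symmetric]\<close>)
qed

lemma integrable_weightN:
  assumes "superlinear b" and "continuous_on UNIV b" and "\<tau> > 0"
  shows "integrable lborel (\<lambda>l. exp (2 * \<tau> * (\<eta> * l - b l)))"
  using integrable_weight[OF assms(1,2), of "2 * \<tau>" \<eta> 0] assms(3) by simp

text \<open>
  The factor \<open>exp (\<tau> \<rho> \<bar>\<eta>\<bar>)\<close> is what later makes the integral over \<open>\<eta>\<close> converge.  It comes from
  keeping only the outer half of the interval of radius \<open>\<rho>\<close> about \<open>x\<close>, on the side where
  \<open>\<eta> (l - x)\<close> is nonnegative.
\<close>

lemma weightN_lower:
  assumes b: "superlinear b" and c: "continuous_on UNIV b" and \<tau>: "\<tau> > 0" and \<rho>: "\<rho> > 0"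
    and near: "\<And>l. \<bar>l - x\<bar> \<le> \<rho> \<Longrightarrow> b l \<le> b x + \<epsilon>"
  shows "\<rho> / 2 * exp (2 * \<tau> * (\<eta> * x - b x - \<epsilon>) + \<tau> * \<rho> * \<bar>\<eta>\<bar>) \<le> weightN b \<eta> \<tau>"
proof -
  define I where "I = (if \<eta> \<ge> 0 then {x + \<rho>/2..x + \<rho>} else {x - \<rho>..x - \<rho>/2})"
  define E where "E = exp (2 * \<tau> * (\<eta> * x - b x - \<epsilon>) + \<tau> * \<rho> * \<bar>\<eta>\<bar>)"
  have I: "I \<in> sets lborel" "measure lborel I = \<rho> / 2" "emeasure lborel I < \<infinity>"
    using \<rho> by (auto simp: I_def)
  have E: "E \<le> exp (2 * \<tau> * (\<eta> * l - b l))" if l: "l \<in> I" for l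
  proof -
    have 1: "b l \<le> b x + \<epsilon>"
      using l \<rho> by (intro near) (auto simp: I_def split: if_splits)
    have "\<bar>\<eta>\<bar> * (\<rho> / 2) \<le> \<bar>\<eta>\<bar> * \<bar>l - x\<bar>"
      using l \<rho> by (intro mult_left_mono) (auto simp: I_def split: if_splits)
    also have "\<dots> = \<eta> * (l - x)"
      using l \<rho> by (auto simp: I_def abs_if algebra_simps split: if_splits)
    finally have "\<eta> * x - b x - \<epsilon> + \<bar>\<eta>\<bar> * (\<rho> / 2) \<le> \<eta> * l - b l"
      using 1 by (simp add: algebra_simps)
    with \<tau> have "2 * \<tau> * (\<eta> * x - b x - \<epsilon> + \<bar>\<eta>\<bar> * (\<rho> / 2)) \<le> 2 * \<tau> * (\<eta> * l - b l)"
      by (intro mult_left_mono) auto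
    then show ?thesis by (simp add: E_def algebra_simps)
  qed
  have "\<rho> / 2 * E = (LINT l|lborel. E * indicator I l)"
    using I by simp
  also have "\<dots> \<le> weightN b \<eta> \<tau>"
    unfolding weightN_def
  proof (rule integral_mono)
    show "integrable lborel (\<lambda>l. E * indicator I l)"
      using I by (intro integrable_mult_right integrable_real_indicator) auto
    show "integrable lborel (\<lambda>l. exp (2 * \<tau> * (\<eta> * l - b l)))"
      by (rule integrable_weightN[OF b c \<tau>])
  qed (use E in \<open>auto simp: indicator_def\<close>)
  finally show ?thesis by (simp add: E_def)
qed

lemma continuous_near:
  fixes b :: "real \<Rightarrow> real"
  assumes c: "continuous_on UNIV b" and "\<epsilon> > 0"
  obtains \<rho> where "\<rho> > 0" "\<And>l. \<bar>l - x\<bar> \<le> \<rho> \<Longrightarrow> b l \<le> b x + \<epsilon>"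
proof -
  obtain d where d: "d > 0" "\<And>l. dist l x < d \<Longrightarrow> dist (b l) (b x) < \<epsilon>"
    using c \<open>\<epsilon> > 0\<close> unfolding continuous_on_iff by (metis UNIV_I)
  show ?thesis
  proof
    show "d / 2 > 0" using d by simp
    show "b l \<le> b x + \<epsilon>" if "\<bar>l - x\<bar> \<le> d / 2" for l
      using d(2)[of l] that d(1) by (auto simp: dist_real_def)
  qed
qed

lemma weightN_pos:
  assumes b: "superlinear b" and c: "continuous_on UNIV b" and \<tau>: "\<tau> > 0"
  shows "weightN b \<eta> \<tau> > 0"
proof -
  obtain \<rho> where \<rho>: "\<rho> > 0" "\<And>l. \<bar>l - 0\<bar> \<le> \<rho> \<Longrightarrow> b l \<le> b 0 + 1"
    using continuous_near[OF c, of 1 0] by auto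
  have "0 < \<rho> / 2 * exp (2 * \<tau> * (\<eta> * 0 - b 0 - 1) + \<tau> * \<rho> * \<bar>\<eta>\<bar>)"
    using \<rho>(1) by simp
  also have "\<dots> \<le> weightN b \<eta> \<tau>"
    using weightN_lower[OF b c \<tau> \<rho>] by blast
  finally show ?thesis .
qed

section \<open>The positive density of the kernel\<close>

definition szego_density :: "(real \<Rightarrow> real) \<Rightarrow> real \<Rightarrow> real \<Rightarrow> real \<Rightarrow> real \<Rightarrow> real" where
  "szego_density b x r \<eta> \<tau> = \<tau> * exp (\<tau> * (\<eta> * (x + r) - b x - b r)) / weightN b \<eta> \<tau>"

definition fibre_integral :: "(real \<Rightarrow> real) \<Rightarrow> real \<Rightarrow> real \<Rightarrow> real \<Rightarrow> real" where
  "fibre_integral b x r \<tau> = (LINT \<eta>|lborel. szego_density b x r \<eta> \<tau>)"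

lemma szego_integrand_eq_density:
  "szego_integrand b (Complex x y, Complex t (b x + h)) (Complex r y, Complex t (b r + k)) \<eta> \<tau>
     = of_real (exp (- (\<tau> * (h + k))) * szego_density b x r \<eta> \<tau>)"
proof -
  have "of_real (\<eta> * \<tau>) * (Complex x y + cnj (Complex r y))
          + \<i> * of_real \<tau> * (Complex t (b x + h) - cnj (Complex t (b r + k)))
      = of_real (- (\<tau> * (h + k)) + \<tau> * (\<eta> * (x + r) - b x - b r))"
    by (simp add: complex_eq_iff algebra_simps)
  then show ?thesis
    by (simp only: szego_integrand_def szego_density_def fst_conv snd_conv exp_of_real exp_add)
       simp
qed

lemma szego_bdry_integrand_eq_density:
  "szego_bdry_integrand b (x, y, t) (r, y, t) \<eta> \<tau> = of_real (szego_density b x r \<eta> \<tau>)"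
  using szego_integrand_eq_density[of b x y t 0 r 0 \<eta> \<tau>]
    szego_integrand_bdry_point[of b "(x, y, t)" "(r, y, t)" \<eta> \<tau>] by simp

lemma szego_density_pos:
  assumes "superlinear b" and "continuous_on UNIV b" and "\<tau> > 0"
  shows "szego_density b x r \<eta> \<tau> > 0"
  using weightN_pos[OF assms, of \<eta>] assms(3) by (simp add: szego_density_def)

lemma szego_density_measurable:
  assumes "continuous_on UNIV b"
  shows "(\<lambda>(\<eta>, \<tau>). szego_density b x r \<eta> \<tau>) \<in> borel_measurable (borel \<Otimes>\<^sub>M borel)"
proof -
  have [measurable]: "b \<in> borel_measurable borel"
    using assms by (rule borel_measurable_continuous_onI)
  have [measurable]: "(\<lambda>p. weightN b (fst p) (snd p)) \<in> borel_measurable (borel \<Otimes>\<^sub>M borel)"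
    unfolding weightN_def by measurable
  show ?thesis
    unfolding szego_density_def case_prod_beta by measurable
qed

lemma fibre_integral_measurable:
  assumes "continuous_on UNIV b"
  shows "fibre_integral b x r \<in> borel_measurable borel"
proof -
  note [measurable] = szego_density_measurable[OF assms, of x r]
  show ?thesis
    unfolding fibre_integral_def[abs_def] by measurable
qed

text \<open>
  The numerator of the density is the geometric mean of its values at \<open>(x, x)\<close> and \<open>(r, r)\<close>, so
  the lower bounds of the weight near \<open>x\<close> and near \<open>r\<close> combine by multiplication.
\<close>

lemma szego_density_upper:
  assumes b: "superlinear b" and c: "continuous_on UNIV b" and \<epsilon>: "\<epsilon> > 0"
  obtains \<rho> where "\<rho> > 0"
    "\<And>\<tau> \<eta>. \<tau> > 0 \<Longrightarrow>
       szego_density b x r \<eta> \<tau> \<le> 2 / \<rho> * \<tau> * exp (2 * \<tau> * \<epsilon>) * exp (- (\<tau> * \<rho> * \<bar>\<eta>\<bar>))"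
proof -
  obtain \<rho>1 where \<rho>1: "\<rho>1 > 0" "\<And>l. \<bar>l - x\<bar> \<le> \<rho>1 \<Longrightarrow> b l \<le> b x + \<epsilon>"
    using continuous_near[OF c \<epsilon>, of x] by auto
  obtain \<rho>2 where \<rho>2: "\<rho>2 > 0" "\<And>l. \<bar>l - r\<bar> \<le> \<rho>2 \<Longrightarrow> b l \<le> b r + \<epsilon>"
    using continuous_near[OF c \<epsilon>, of r] by auto
  define \<rho> where "\<rho> = min \<rho>1 \<rho>2"
  have \<rho>: "\<rho> > 0" using \<rho>1 \<rho>2 by (simp add: \<rho>_def)
  show ?thesis
  proof
    show "\<rho> > 0" by (rule \<rho>)
    fix \<tau> \<eta> :: real assume \<tau>: "\<tau> > 0"
    let ?N = "weightN b \<eta> \<tau>"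
    have N: "?N > 0" by (rule weightN_pos[OF b c \<tau>])
    define F where "F = 2 * \<tau> * \<epsilon> - \<tau> * \<rho> * \<bar>\<eta>\<bar>"
    have "\<rho> / 2 * exp (2 * \<tau> * (\<eta> * x - b x - \<epsilon>) + \<tau> * \<rho> * \<bar>\<eta>\<bar>) \<le> ?N"
      by (rule weightN_lower[OF b c \<tau> \<rho>]) (use \<rho>1 in \<open>auto simp: \<rho>_def\<close>)
    then have "exp (2 * \<tau> * (\<eta> * x - b x) - F) \<le> 2 / \<rho> * ?N"
      using \<rho> by (simp add: F_def field_simps)
    moreover have "\<rho> / 2 * exp (2 * \<tau> * (\<eta> * r - b r - \<epsilon>) + \<tau> * \<rho> * \<bar>\<eta>\<bar>) \<le> ?N"
      by (rule weightN_lower[OF b c \<tau> \<rho>]) (use \<rho>2 in \<open>auto simp: \<rho>_def\<close>)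
    then have "exp (2 * \<tau> * (\<eta> * r - b r) - F) \<le> 2 / \<rho> * ?N"
      using \<rho> by (simp add: F_def field_simps)
    ultimately have "exp (2 * \<tau> * (\<eta> * x - b x) - F) * exp (2 * \<tau> * (\<eta> * r - b r) - F)
        \<le> (2 / \<rho> * ?N) * (2 / \<rho> * ?N)"
      using \<rho> N by (intro mult_mono) auto
    also have "exp (2 * \<tau> * (\<eta> * x - b x) - F) * exp (2 * \<tau> * (\<eta> * r - b r) - F)
        = (exp (\<tau> * (\<eta> * (x + r) - b x - b r) - F))\<^sup>2"
      by (simp add: power2_eq_square exp_add[symmetric] algebra_simps)
    finally have "exp (\<tau> * (\<eta> * (x + r) - b x - b r) - F) \<le> 2 / \<rho> * ?N"
      unfolding power2_eq_square[symmetric] using \<rho> N by (auto intro: power2_le_imp_le)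
    then have "exp (\<tau> * (\<eta> * (x + r) - b x - b r) - F) * exp F \<le> 2 / \<rho> * ?N * exp F"
      by (intro mult_right_mono) auto
    then have "exp (\<tau> * (\<eta> * (x + r) - b x - b r)) \<le> 2 / \<rho> * ?N * exp F"
      by (simp only: exp_add[symmetric] diff_add_cancel)
    then have "\<tau> * exp (\<tau> * (\<eta> * (x + r) - b x - b r)) \<le> \<tau> * (2 / \<rho> * ?N * exp F)"
      using \<tau> by (intro mult_left_mono) auto
    then have "szego_density b x r \<eta> \<tau> \<le> 2 / \<rho> * \<tau> * exp F"
      using N by (simp add: szego_density_def field_simps)
    then show "szego_density b x r \<eta> \<tau> \<le> 2 / \<rho> * \<tau> * exp (2 * \<tau> * \<epsilon>) * exp (- (\<tau> * \<rho> * \<bar>\<eta>\<bar>))"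
      by (simp add: F_def exp_diff exp_minus field_simps)
  qed
qed

lemma szego_density_integrable:
  assumes b: "superlinear b" and c: "continuous_on UNIV b" and \<tau>: "\<tau> > 0"
  shows "integrable lborel (\<lambda>\<eta>. szego_density b x r \<eta> \<tau>)"
proof -
  obtain \<rho> where \<rho>: "\<rho> > 0" "\<And>\<tau> \<eta>. \<tau> > 0 \<Longrightarrow>
       szego_density b x r \<eta> \<tau> \<le> 2 / \<rho> * \<tau> * exp (2 * \<tau> * 1) * exp (- (\<tau> * \<rho> * \<bar>\<eta>\<bar>))"
    using szego_density_upper[OF b c, of 1 x r] by auto
  note [measurable] = szego_density_measurable[OF c, of x r]
  have "integrable lborel (\<lambda>\<eta>. 2 / \<rho> * \<tau> * exp (2 * \<tau> * 1) * exp (- (\<tau> * \<rho> * \<bar>\<eta>\<bar>)))"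
    using \<tau> \<rho>(1) by (intro integrable_mult_right integrable_exp_neg_abs) simp
  then show ?thesis
  proof (rule Bochner_Integration.integrable_bound)
    show "AE \<eta> in lborel. norm (szego_density b x r \<eta> \<tau>)
        \<le> norm (2 / \<rho> * \<tau> * exp (2 * \<tau> * 1) * exp (- (\<tau> * \<rho> * \<bar>\<eta>\<bar>)))"
    proof (rule AE_I2)
      fix \<eta> :: real
      show "norm (szego_density b x r \<eta> \<tau>)
          \<le> norm (2 / \<rho> * \<tau> * exp (2 * \<tau> * 1) * exp (- (\<tau> * \<rho> * \<bar>\<eta>\<bar>)))"
        using \<rho>(2)[OF \<tau>, of \<eta>] szego_density_pos[OF b c \<tau>, of x r \<eta>]
        unfolding real_norm_def by linarith
    qed
  qed measurable
qed

lemma fibre_integral_nonneg: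
  assumes "superlinear b" and "continuous_on UNIV b" and "\<tau> > 0"
  shows "fibre_integral b x r \<tau> \<ge> 0"
  unfolding fibre_integral_def
  by (intro integral_nonneg_AE AE_I2 less_imp_le szego_density_pos assms)

text \<open>
  The factor \<open>\<tau>\<close> of the density is absorbed by the width \<open>1/\<tau>\<close> of the exponential in \<open>\<eta>\<close>, so the
  fibre integrals stay bounded as \<open>\<tau>\<close> tends to \<open>0\<close> and a single bound holds on all of \<open>\<tau> > 0\<close>.
\<close>

lemma fibre_integral_upper:
  assumes b: "superlinear b" and c: "continuous_on UNIV b" and \<epsilon>: "\<epsilon> > 0"
  obtains A where "\<And>\<tau>. \<tau> > 0 \<Longrightarrow> fibre_integral b x r \<tau> \<le> A * exp (2 * \<tau> * \<epsilon>)"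
proof -
  obtain \<rho> where \<rho>: "\<rho> > 0" "\<And>\<tau> \<eta>. \<tau> > 0 \<Longrightarrow>
       szego_density b x r \<eta> \<tau> \<le> 2 / \<rho> * \<tau> * exp (2 * \<tau> * \<epsilon>) * exp (- (\<tau> * \<rho> * \<bar>\<eta>\<bar>))"
    using szego_density_upper[OF b c \<epsilon>, of x r] by auto
  define L where "L = (LINT \<eta>|lborel. exp (- \<bar>\<eta>\<bar> :: real))"
  show ?thesis
  proof
    fix \<tau> :: real assume \<tau>: "\<tau> > 0"
    have "L = \<bar>\<tau> * \<rho>\<bar> *\<^sub>R (LINT \<eta>|lborel. exp (- \<bar>0 + (\<tau> * \<rho>) * \<eta>\<bar>))"
      unfolding L_def using \<tau> \<rho>(1) by (intro lborel_integral_real_affine) simp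
    then have L: "(LINT \<eta>|lborel. exp (- (\<tau> * \<rho> * \<bar>\<eta>\<bar>))) = L / (\<tau> * \<rho>)"
      using \<tau> \<rho>(1) by (simp add: abs_mult)
    have "fibre_integral b x r \<tau>
        \<le> (LINT \<eta>|lborel. 2 / \<rho> * \<tau> * exp (2 * \<tau> * \<epsilon>) * exp (- (\<tau> * \<rho> * \<bar>\<eta>\<bar>)))"
      unfolding fibre_integral_def
      using \<tau> \<rho> by (intro integral_mono szego_density_integrable b c
          integrable_mult_right integrable_exp_neg_abs) simp_all
    also have "\<dots> = 2 / \<rho> * \<tau> * exp (2 * \<tau> * \<epsilon>) * (LINT \<eta>|lborel. exp (- (\<tau> * \<rho> * \<bar>\<eta>\<bar>)))"
      by simp
    also have "\<dots> = (2 / \<rho> * (L / \<rho>)) * exp (2 * \<tau> * \<epsilon>)"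
      unfolding L using \<tau> \<rho>(1) by (simp add: field_simps)
    finally show "fibre_integral b x r \<tau> \<le> (2 / \<rho> * (L / \<rho>)) * exp (2 * \<tau> * \<epsilon>)" .
  qed
qed

section \<open>The lower bound at common maximizers\<close>

text \<open>
  Because \<open>x\<close> and \<open>r\<close> share the slope \<open>\<eta>\<^sub>0\<close>, the numerator of the density reaches the rate
  \<open>exp (2 \<tau> M)\<close>, with \<open>M\<close> the common maximum, and the weight grows no faster.  For the latter, note
  that \<open>2 \<tau> (\<eta>\<^sub>0 l - b l - M) \<le> 0\<close> is largest over \<open>\<tau> \<ge> 1\<close> at \<open>\<tau> = 1\<close>; and moving \<open>\<eta>\<close> within the window
  changes the exponent by at most \<open>2 \<bar>l\<bar>\<close>.  So one convergent integral \<open>K\<close> serves for all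
  \<open>\<tau> \<ge> 1\<close>.
\<close>

lemma fibre_integral_lower:
  assumes b: "superlinear b" and c: "continuous_on UNIV b"
    and x: "\<And>l. \<eta>0 * l - b l \<le> \<eta>0 * x - b x"
    and r: "\<And>l. \<eta>0 * l - b l \<le> \<eta>0 * r - b r"
  obtains \<kappa> where "\<kappa> > 0" "\<And>\<tau>. \<tau> \<ge> 1 \<Longrightarrow> \<kappa> \<le> fibre_integral b x r \<tau>"
proof -
  define M where "M = \<eta>0 * x - b x"
  have Mr: "M = \<eta>0 * r - b r"
    using x[of r] r[of x] by (simp add: M_def)
  define K0 where "K0 = (LINT l|lborel. exp (2 * (\<eta>0 * l - b l) + 2 * \<bar>l\<bar>))"
  define K where "K = K0 * exp (- 2 * M)"
  have window: "\<bar>\<tau> * (\<eta> - \<eta>0)\<bar> \<le> 1" if "\<tau> \<ge> 1" "\<bar>\<eta> - \<eta>0\<bar> \<le> 1 / \<tau>" for \<eta> \<tau>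
    using that mult_left_mono[OF that(2), of \<tau>] by (simp add: abs_mult)
  have upper: "weightN b \<eta> \<tau> \<le> exp (2 * \<tau> * M) * K"
    if \<tau>: "\<tau> \<ge> 1" and \<eta>: "\<bar>\<eta> - \<eta>0\<bar> \<le> 1 / \<tau>" for \<eta> \<tau>
  proof -
    have "weightN b \<eta> \<tau>
        \<le> (LINT l|lborel. exp (2 * \<tau> * M - 2 * M) * exp (2 * (\<eta>0 * l - b l) + 2 * \<bar>l\<bar>))"
      unfolding weightN_def
    proof (rule integral_mono)
      show "integrable lborel (\<lambda>l. exp (2 * \<tau> * (\<eta> * l - b l)))"
        using \<tau> by (intro integrable_weightN b c) simp
      show "integrable lborel (\<lambda>l. exp (2 * \<tau> * M - 2 * M) * exp (2 * (\<eta>0 * l - b l) + 2 * \<bar>l\<bar>))"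
        by (intro integrable_mult_right integrable_weight b c) simp
      fix l :: real
      have "\<tau> * (\<eta> - \<eta>0) * l \<le> \<bar>\<tau> * (\<eta> - \<eta>0)\<bar> * \<bar>l\<bar>"
        by (metis abs_ge_self abs_mult)
      also have "\<dots> \<le> 1 * \<bar>l\<bar>"
        by (intro mult_right_mono window \<tau> \<eta> abs_ge_zero)
      finally have 1: "\<tau> * (\<eta> - \<eta>0) * l \<le> \<bar>l\<bar>" by simp
      have 2: "1 * (M - (\<eta>0 * l - b l)) \<le> \<tau> * (M - (\<eta>0 * l - b l))"
        using \<tau> x[of l] by (intro mult_right_mono) (simp_all add: M_def)
      have "2 * \<tau> * (\<eta> * l - b l)
          = 2 * (\<tau> * (\<eta> - \<eta>0) * l) + 2 * \<tau> * M - 2 * (\<tau> * (M - (\<eta>0 * l - b l)))"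
        by (simp add: algebra_simps)
      also have "\<dots> \<le> 2 * \<bar>l\<bar> + 2 * \<tau> * M - 2 * (M - (\<eta>0 * l - b l))"
        using 1 2 by linarith
      finally show "exp (2 * \<tau> * (\<eta> * l - b l))
          \<le> exp (2 * \<tau> * M - 2 * M) * exp (2 * (\<eta>0 * l - b l) + 2 * \<bar>l\<bar>)"
        by (simp add: exp_add[symmetric])
    qed
    also have "\<dots> = exp (2 * \<tau> * M - 2 * M) * K0"
      by (simp add: K0_def)
    also have "\<dots> = exp (2 * \<tau> * M) * K"
      by (simp add: K_def exp_diff exp_minus field_simps)
    finally show ?thesis .
  qed
  have "0 < weightN b \<eta>0 1"
    by (rule weightN_pos[OF b c]) simp
  also have "\<dots> \<le> exp (2 * 1 * M) * K"
    by (rule upper) simp_all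
  finally have K: "K > 0"
    by (simp add: zero_less_mult_iff)
  define \<kappa> where "\<kappa> = 2 * exp (- \<bar>x + r\<bar>) / K"
  show ?thesis
  proof
    show "\<kappa> > 0" using K by (simp add: \<kappa>_def)
    fix \<tau> :: real assume \<tau>: "\<tau> \<ge> 1"
    let ?I = "{\<eta>0 - 1 / \<tau>..\<eta>0 + 1 / \<tau>}"
    have dens: "\<tau> * exp (- \<bar>x + r\<bar>) / K \<le> szego_density b x r \<eta> \<tau>" if "\<eta> \<in> ?I" for \<eta>
    proof -
      have \<eta>: "\<bar>\<eta> - \<eta>0\<bar> \<le> 1 / \<tau>" using that by (auto simp: abs_le_iff)
      have N: "0 < weightN b \<eta> \<tau>" using \<tau> by (intro weightN_pos b c) simp
      have "- (\<tau> * (\<eta> - \<eta>0) * (x + r)) \<le> \<bar>\<tau> * (\<eta> - \<eta>0)\<bar> * \<bar>x + r\<bar>"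
        by (metis abs_ge_minus_self abs_mult)
      also have "\<dots> \<le> 1 * \<bar>x + r\<bar>"
        by (intro mult_right_mono window \<tau> \<eta> abs_ge_zero)
      finally have "2 * \<tau> * M - \<bar>x + r\<bar> \<le> \<tau> * (\<eta> - \<eta>0) * (x + r) + \<tau> * (M + M)"
        by simp
      also have "\<dots> = \<tau> * (\<eta> - \<eta>0) * (x + r) + \<tau> * ((\<eta>0 * x - b x) + (\<eta>0 * r - b r))"
        using Mr by (simp add: M_def)
      also have "\<dots> = \<tau> * (\<eta> * (x + r) - b x - b r)"
        by (simp add: algebra_simps)
      finally have "exp (2 * \<tau> * M - \<bar>x + r\<bar>) \<le> exp (\<tau> * (\<eta> * (x + r) - b x - b r))"
        by simp
      then have "\<tau> * exp (2 * \<tau> * M - \<bar>x + r\<bar>) / (exp (2 * \<tau> * M) * K) \<le> szego_density b x r \<eta> \<tau>"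
        unfolding szego_density_def using \<tau> N upper[OF \<tau> \<eta>]
        by (intro frac_le mult_left_mono) auto
      then show ?thesis
        by (simp add: exp_diff exp_minus field_simps)
    qed
    have "\<kappa> = (LINT \<eta>|lborel. \<tau> * exp (- \<bar>x + r\<bar>) / K * indicator ?I \<eta>)"
      using \<tau> by (simp add: \<kappa>_def)
    also have "\<dots> \<le> fibre_integral b x r \<tau>"
      unfolding fibre_integral_def
    proof (rule integral_mono)
      show "integrable lborel (\<lambda>\<eta>. \<tau> * exp (- \<bar>x + r\<bar>) / K * indicator ?I \<eta>)"
        by (intro integrable_mult_right integrable_real_indicator)
           (auto simp: emeasure_lborel_Icc_eq)
      show "integrable lborel (\<lambda>\<eta>. szego_density b x r \<eta> \<tau>)"
        using \<tau> by (intro szego_density_integrable b c) simp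
    qed (use dens \<tau> szego_density_pos[OF b c, of \<tau> x r] in
         \<open>auto simp: indicator_def intro: less_imp_le\<close>)
    finally show "\<kappa> \<le> fibre_integral b x r \<tau>" .
  qed
qed

section \<open>Divergence of the kernel\<close>

lemma emeasure_lborel_atLeast: "emeasure lborel {a::real..} = \<infinity>"
proof (rule ccontr)
  assume "emeasure lborel {a..} \<noteq> \<infinity>"
  then obtain m where m: "m \<ge> 0" "emeasure lborel {a..} = ennreal m"
    by (cases "emeasure lborel {a..}") auto
  have "emeasure lborel {a..a + (m + 1)} \<le> emeasure lborel {a..}"
    by (intro emeasure_mono) auto
  with m show False by simp
qed

lemma szego_bdry_infinite_at_maximizers:
  assumes b: "superlinear b" and c: "continuous_on UNIV b" and C: "C > 0"
    and x: "\<And>l. \<eta>0 * l - b l \<le> \<eta>0 * x - b x"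
    and r: "\<And>l. \<eta>0 * l - b l \<le> \<eta>0 * r - b r"
  shows "szego_bdry_infinite C b (x, y, t) (r, y, t)"
proof -
  obtain \<kappa> where \<kappa>: "\<kappa> > 0" "\<And>\<tau>. \<tau> \<ge> 1 \<Longrightarrow> \<kappa> \<le> fibre_integral b x r \<tau>"
    using fibre_integral_lower[OF b c x r] by auto
  have "\<infinity> = (\<integral>\<^sup>+(\<tau>::real). ennreal \<kappa> * indicator {1..} \<tau> \<partial>lborel)"
    using \<kappa>(1) by (subst nn_integral_cmult_indicator)
      (auto simp: ennreal_mult_top emeasure_lborel_atLeast)
  also have "\<dots> \<le> (\<integral>\<^sup>+\<tau>\<in>{0<..}. (\<integral>\<^sup>+\<eta>. ennreal (szego_density b x r \<eta> \<tau>) \<partial>lborel) \<partial>lborel)"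
  proof (intro nn_integral_mono)
    fix \<tau> :: real
    have "ennreal \<kappa> \<le> (\<integral>\<^sup>+\<eta>. ennreal (szego_density b x r \<eta> \<tau>) \<partial>lborel)" if \<tau>: "\<tau> \<ge> 1"
    proof -
      have "(\<integral>\<^sup>+\<eta>. ennreal (szego_density b x r \<eta> \<tau>) \<partial>lborel) = ennreal (fibre_integral b x r \<tau>)"
        unfolding fibre_integral_def
        using \<tau> by (intro nn_integral_eq_integral szego_density_integrable b c AE_I2 less_imp_le
            szego_density_pos) simp_all
      then show ?thesis using \<kappa>(2)[OF \<tau>] by (simp add: ennreal_leI)
    qed
    then show "ennreal \<kappa> * indicator {1..} \<tau>
        \<le> (\<integral>\<^sup>+\<eta>. ennreal (szego_density b x r \<eta> \<tau>) \<partial>lborel) * indicator {0<..} \<tau>"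
      by (auto simp: indicator_def)
  qed
  finally have "(\<integral>\<^sup>+\<tau>\<in>{0<..}. (\<integral>\<^sup>+\<eta>. ennreal (szego_density b x r \<eta> \<tau>) \<partial>lborel) \<partial>lborel) = \<infinity>"
    by (simp add: top_unique)
  then show ?thesis
    using C szego_density_pos[OF b c]
    unfolding szego_bdry_infinite_def szego_bdry_integrand_eq_density
    by (simp add: ennreal_mult_top)
qed

lemma szego_eq_Laplace_integral:
  "szego C b (Complex x y, Complex t (b x + h)) (Complex r y, Complex t (b r + k))
     = of_real (C * (LINT \<tau>:{0<..}|lborel. exp (- (\<tau> * (h + k))) * fibre_integral b x r \<tau>))"
proof -
  have "(LINT \<eta>|lborel. szego_integrand b (Complex x y, Complex t (b x + h))
            (Complex r y, Complex t (b r + k)) \<eta> \<tau>)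
      = of_real (exp (- (\<tau> * (h + k))) * fibre_integral b x r \<tau>)" for \<tau>
    unfolding szego_integrand_eq_density fibre_integral_def
    by (subst integral_complex_of_real) simp
  then show ?thesis
    unfolding szego_def set_lebesgue_integral_def
    by (simp add: scaleR_conv_of_real flip: of_real_mult)
qed

lemma Laplace_fibre_integrable:
  assumes b: "superlinear b" and c: "continuous_on UNIV b" and \<delta>: "\<delta> > 0"
  shows "set_integrable lborel {0<..} (\<lambda>\<tau>. exp (- (\<tau> * \<delta>)) * fibre_integral b x r \<tau>)"
proof -
  obtain A where A: "\<And>\<tau>. \<tau> > 0 \<Longrightarrow> fibre_integral b x r \<tau> \<le> A * exp (2 * \<tau> * (\<delta> / 4))"
    using fibre_integral_upper[OF b c, of "\<delta> / 4" x r] \<delta> by auto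
  note [measurable] = fibre_integral_measurable[OF c, of x r]
  have "integrable lborel (\<lambda>\<tau>. A * exp (- (\<delta> / 2 * \<bar>\<tau>\<bar>)))"
    using \<delta> by (intro integrable_mult_right integrable_exp_neg_abs) simp
  then show ?thesis
    unfolding set_integrable_def
  proof (rule Bochner_Integration.integrable_bound)
    have "norm (indicator {0<..} \<tau> *\<^sub>R (exp (- (\<tau> * \<delta>)) * fibre_integral b x r \<tau>))
        \<le> norm (A * exp (- (\<delta> / 2 * \<bar>\<tau>\<bar>)))" for \<tau> :: real
    proof (cases "\<tau> > 0")
      case True
      have "exp (- (\<tau> * \<delta>)) * fibre_integral b x r \<tau> \<le> exp (- (\<tau> * \<delta>)) * (A * exp (2 * \<tau> * (\<delta> / 4)))"
        using A[OF True] by (intro mult_left_mono) auto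
      also have "\<dots> = A * exp (- (\<tau> * \<delta>) + 2 * \<tau> * (\<delta> / 4))"
        by (simp only: exp_add mult_ac)
      also have "- (\<tau> * \<delta>) + 2 * \<tau> * (\<delta> / 4) = - (\<delta> / 2 * \<bar>\<tau>\<bar>)"
        using True by (simp add: field_simps)
      finally show ?thesis
        using True fibre_integral_nonneg[OF b c True, of x r]
          abs_ge_self[of "A * exp (- (\<delta> / 2 * \<bar>\<tau>\<bar>))"]
        by simp
    qed simp
    then show "AE \<tau> in lborel. norm (indicator {0<..} \<tau> *\<^sub>R (exp (- (\<tau> * \<delta>)) * fibre_integral b x r \<tau>))
        \<le> norm (A * exp (- (\<delta> / 2 * \<bar>\<tau>\<bar>)))"
      by simp
  qed measurable
qed

lemma Laplace_fibre_at_top: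
  assumes b: "superlinear b" and c: "continuous_on UNIV b"
    and x: "\<And>l. \<eta>0 * l - b l \<le> \<eta>0 * x - b x"
    and r: "\<And>l. \<eta>0 * l - b l \<le> \<eta>0 * r - b r"
  shows "filterlim (\<lambda>\<delta>. LINT \<tau>:{0<..}|lborel. exp (- (\<tau> * \<delta>)) * fibre_integral b x r \<tau>)
           at_top (at_right 0)"
proof -
  obtain \<kappa> where \<kappa>: "\<kappa> > 0" "\<And>\<tau>. \<tau> \<ge> 1 \<Longrightarrow> \<kappa> \<le> fibre_integral b x r \<tau>"
    using fibre_integral_lower[OF b c x r] by auto
  have lower: "exp (- 2) * \<kappa> * inverse \<delta>
      \<le> (LINT \<tau>:{0<..}|lborel. exp (- (\<tau> * \<delta>)) * fibre_integral b x r \<tau>)"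
    if \<delta>: "\<delta> > 0" "\<delta> < 1" for \<delta>
  proof -
    \<comment> \<open>On this interval of length \<open>1/\<delta>\<close> the Laplace factor is at least \<open>exp (- \<delta> - 1) \<ge> exp (- 2)\<close>.\<close>
    let ?I = "{1..1 + 1 / \<delta>}"
    have "exp (- 2) * \<kappa> * inverse \<delta> = (LINT \<tau>|lborel. exp (- 2) * \<kappa> * indicator ?I \<tau>)"
      using \<delta> by (simp add: field_simps)
    also have "\<dots> \<le> (LINT \<tau>:{0<..}|lborel. exp (- (\<tau> * \<delta>)) * fibre_integral b x r \<tau>)"
      unfolding set_lebesgue_integral_def
    proof (rule integral_mono)
      show "integrable lborel (\<lambda>\<tau>. exp (- 2) * \<kappa> * indicator ?I \<tau>)"
        by (intro integrable_mult_right integrable_real_indicator)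
           (auto simp: emeasure_lborel_Icc_eq)
      show "integrable lborel
          (\<lambda>\<tau>. indicator {0<..} \<tau> *\<^sub>R (exp (- (\<tau> * \<delta>)) * fibre_integral b x r \<tau>))"
        using Laplace_fibre_integrable[OF b c \<delta>(1)] by (simp add: set_integrable_def)
      fix \<tau> :: real
      show "exp (- 2) * \<kappa> * indicator ?I \<tau>
          \<le> indicator {0<..} \<tau> *\<^sub>R (exp (- (\<tau> * \<delta>)) * fibre_integral b x r \<tau>)"
      proof (cases "\<tau> \<in> ?I")
        case True
        then have "\<tau> * \<delta> \<le> (1 + 1 / \<delta>) * \<delta>"
          using \<delta> by (intro mult_right_mono) auto
        also have "\<dots> \<le> 2"
          using \<delta> by (simp add: field_simps)
        finally have "exp (- 2) * \<kappa> \<le> exp (- (\<tau> * \<delta>)) * fibre_integral b x r \<tau>"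
          using \<kappa> True by (intro mult_mono) auto
        then show ?thesis using True by simp
      next
        case False
        then show ?thesis
          using fibre_integral_nonneg[OF b c, of \<tau> x r] by (auto simp: indicator_def)
      qed
    qed
    finally show ?thesis .
  qed
  have "filterlim (\<lambda>\<delta>. (exp (- 2) * \<kappa>) * inverse \<delta>) at_top (at_right (0::real))"
    using \<kappa>(1) filterlim_inverse_at_top_right
    by (intro filterlim_tendsto_pos_mult_at_top[OF tendsto_const]) auto
  moreover have "\<forall>\<^sub>F \<delta> in at_right 0. exp (- 2) * \<kappa> * inverse \<delta>
      \<le> (LINT \<tau>:{0<..}|lborel. exp (- (\<tau> * \<delta>)) * fibre_integral b x r \<tau>)"
    using lower by (auto simp: eventually_at_right_field intro!: exI[of _ 1])
  ultimately show ?thesis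
    by (rule filterlim_at_top_mono)
qed

section \<open>Even-degree polynomials and the set of singular pairs\<close>

lemma superlinear_even_poly:
  fixes a :: "nat \<Rightarrow> real"
  assumes n: "n \<ge> 1" and q: "q > 0"
  shows "superlinear (\<lambda>x. q * x ^ (2 * n) + (\<Sum>j = 2..2 * n - 1. a j * x ^ j))"
    (is "superlinear ?b")
  unfolding superlinear_def
proof
  fix K :: real
  define A where "A = (\<Sum>j = 2..2 * n - 1. \<bar>a j\<bar>)"
  define R where "R = 1 + (A + \<bar>K\<bar>) / q"
  have A: "A \<ge> 0" by (simp add: A_def sum_nonneg)
  have "continuous_on {-R..R} (\<lambda>l. ?b l - K * \<bar>l\<bar>)"
    by (intro continuous_intros)
  then have "bounded ((\<lambda>l. ?b l - K * \<bar>l\<bar>) ` {-R..R})"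
    using compact_Icc compact_continuous_image compact_imp_bounded by blast
  then obtain C where "\<forall>z \<in> (\<lambda>l. ?b l - K * \<bar>l\<bar>) ` {-R..R}. norm z \<le> C"
    unfolding bounded_iff by blast
  then have C: "\<bar>?b l - K * \<bar>l\<bar>\<bar> \<le> C" if "l \<in> {-R..R}" for l
    using that unfolding real_norm_def by blast
  have "K * \<bar>l\<bar> - \<bar>C\<bar> \<le> ?b l" for l
  proof (cases "l \<in> {-R..R}")
    case True
    from C[OF this] show ?thesis by linarith
  next
    case False
    then have R: "\<bar>l\<bar> > R" by auto
    have "R \<ge> 1" using A q by (simp add: R_def)
    with R have l1: "\<bar>l\<bar> \<ge> 1" by linarith
    define P where "P = \<bar>l\<bar> ^ (2 * n - 1)"
    have P: "P \<ge> \<bar>l\<bar>"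
      unfolding P_def using n l1 power_increasing[of 1 "2 * n - 1" "\<bar>l\<bar>"] by simp
    have "\<bar>\<Sum>j = 2..2 * n - 1. a j * l ^ j\<bar> \<le> (\<Sum>j = 2..2 * n - 1. \<bar>a j\<bar> * P)"
      unfolding P_def using l1
      by (intro order.trans[OF sum_abs] sum_mono)
         (auto simp: abs_mult power_abs intro!: mult_left_mono power_increasing)
    also have "\<dots> = A * P" by (simp add: A_def sum_distrib_right)
    finally have 1: "- (A * P) \<le> (\<Sum>j = 2..2 * n - 1. a j * l ^ j)" by linarith
    have "l ^ (2 * n) = \<bar>l\<bar> ^ (2 * n)" by (simp add: power_even_abs)
    also have "\<dots> = \<bar>l\<bar> * P"
      unfolding P_def using n by (subst power_Suc[symmetric]) simp
    finally have 2: "l ^ (2 * n) = \<bar>l\<bar> * P" .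
    have "A + \<bar>K\<bar> \<le> q * \<bar>l\<bar>"
      using R q by (simp add: R_def field_simps)
    then have "(A + \<bar>K\<bar>) * P \<le> q * \<bar>l\<bar> * P"
      using P by (intro mult_right_mono) auto
    moreover have "K * \<bar>l\<bar> \<le> \<bar>K\<bar> * P"
      using P by (intro mult_mono) auto
    ultimately have "K * \<bar>l\<bar> - \<bar>C\<bar> \<le> q * (\<bar>l\<bar> * P) + (\<Sum>j = 2..2 * n - 1. a j * l ^ j)"
      using 1 abs_ge_zero[of C] unfolding distrib_right mult.assoc by linarith
    then show ?thesis by (simp only: 2)
  qed
  then show "\<exists>C. \<forall>l. K * \<bar>l\<bar> - C \<le> ?b l" by blast
qed

text \<open>
  The infimum in \<open>Lambda_at\<close> is a lower bound only if the function is bounded below, which the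
  growth of \<open>b\<close> guarantees.
\<close>

lemma Lambda_at_maximizes:
  assumes b: "superlinear b" and x: "x \<in> Lambda_at b \<eta>"
  shows "\<eta> * l - b l \<le> \<eta> * x - b x"
proof -
  obtain C where C: "\<And>l. \<bar>\<eta>\<bar> * \<bar>l\<bar> - C \<le> b l"
    using b unfolding superlinear_def by blast
  have "- C \<le> Bfun b \<eta> l" for l
    using C[of l] abs_ge_self[of "\<eta> * l"] by (simp add: Bfun_def abs_mult)
  then have "bdd_below (range (Bfun b \<eta>))"
    by (intro bdd_belowI2[of _ "- C"]) auto
  then have "(INF x. Bfun b \<eta> x) \<le> Bfun b \<eta> l"
    by (rule cINF_lower) simp
  with x show ?thesis by (simp add: Lambda_at_def Bfun_def)
qed

text \<open>
  The diagonal part of \<open>\<Sigma>\<close> fits the same description as the other part: there \<open>r = x\<close>, so any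
  slope that works for \<open>x\<close> works for both.
\<close>

lemma Sigma_set_bdry_pointD:
  assumes "(bdry_point b (x, y, t), bdry_point b (r, s, u)) \<in> Sigma_set b"
  obtains \<eta> where "x \<in> Lambda_at b \<eta>" "r \<in> Lambda_at b \<eta>"
  using assms by (auto simp: Sigma_set_def Lambda_def)

theorem theorem2p5:
  fixes n :: nat and a :: "nat \<Rightarrow> real" and b :: "real \<Rightarrow> real" and c x r y t :: real
  assumes "n \<ge> 2"
    and "b = (\<lambda>x. 1 / (2 * real n) * x ^ (2 * n) + (\<Sum>j = 2..2 * n - 1. a j * x ^ j))"
    and "c > 0"
    and "(bdry_point b (x, y, t), bdry_point b (r, y, t)) \<in> Sigma_set b"
  shows "szego_bdry_infinite c b (x, y, t) (r, y, t) \<and>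
         tends_to_pinfty
           (\<lambda>(h, k). szego c b (Complex x y, Complex t (b x + h)) (Complex r y, Complex t (b r + k)))
           (filtercomap (\<lambda>(h, k). h + k) (at_right 0))"
proof
  have b: "superlinear b"
    unfolding assms(2) using assms(1) by (intro superlinear_even_poly) auto
  have cont: "continuous_on UNIV b"
    unfolding assms(2) by (intro continuous_intros)
  obtain \<eta>0 where \<eta>0: "x \<in> Lambda_at b \<eta>0" "r \<in> Lambda_at b \<eta>0"
    using assms(4) by (rule Sigma_set_bdry_pointD)
  note x = Lambda_at_maximizes[OF b \<eta>0(1)] and r = Lambda_at_maximizes[OF b \<eta>0(2)]
  show "szego_bdry_infinite c b (x, y, t) (r, y, t)"
    by (rule szego_bdry_infinite_at_maximizers[OF b cont assms(3) x r])
  have "filterlim (\<lambda>\<delta>. c * (LINT \<tau>:{0<..}|lborel. exp (- (\<tau> * \<delta>)) * fibre_integral b x r \<tau>))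
      at_top (at_right 0)"
    using assms(3) Laplace_fibre_at_top[OF b cont x r]
    by (intro filterlim_tendsto_pos_mult_at_top[OF tendsto_const])
  from filterlim_compose[OF this filterlim_filtercomap[of "\<lambda>(h, k). h + k"]]
  show "tends_to_pinfty
      (\<lambda>(h, k). szego c b (Complex x y, Complex t (b x + h)) (Complex r y, Complex t (b r + k)))
      (filtercomap (\<lambda>(h, k). h + k) (at_right 0))"
    unfolding tends_to_pinfty_def szego_eq_Laplace_integral
    by (simp add: case_prod_beta)
qed

end
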